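(* Let $\bar A'\in\{0,1\}^{n\times n}$, $\bar B'\in\{0,1\}^{n\times p}$, $\bar H\in\{0,1\}^{n\times n}$, and let $\bar E\in\{0,1\}^{r\times r}$ satisfy $\bar E_{i,i}=0$ for $i=1,\dots,r$. Let $(\bar A,\bar B)$ be the interconnected dynamical system composed of $r$ similar components and parametrized by $(\bar A',\bar B',\bar H,\bar E)$, i.e. $\bar A=(I_r\otimes \bar A')\lor(\bar E\otimes\bar H)$ and $\bar B=I_r\otimes \bar B'$, where $(\bar A',\bar B')$ is not structurally controllable. Then $(\bar A,\bar B)$ is structurally controllable if both $(\bar A'\lor\bar H,\bar B')$ is structurally controllable and the condensed graph $\mathcal D^*(\bar A)$ is spanned by cycles.
   Context: Here $\otimes$ is the Kronecker product and $\lor$ the entrywise logical OR of binary matrices. Structural controllability: for binary matrices $\bar M\in\{0,1\}^{n\times n}$ and $\bar N\in\{0,1\}^{n\times p}$, the pair $(\bar M,\bar N)$ is structurally controllable if there is a controllable pair of real matrices $(M,N)$ (for $\dot x=Mx+Nu$) with the same sparsity pattern, i.e. $M_{i,j}=0$ iff $\bar M_{i,j}=0$ and $N_{i,k}=0$ iff $\bar N_{i,k}=0$. Condensed graph: $\mathcal D^*(\bar A)$ is the digraph with vertices $a_1,\dots,a_r$ (one per subsystem) and an edge $(a_i,a_j)$ from $a_i$ to $a_j$ whenever there is a nonzero connection matrix from subsystem $i$ to subsystem $j$; for a system composed of similar components parametrized by $(\bar A',\bar B',\bar H,\bar E)$ it is the digraph $\mathcal D(\bar E)$, having an edge $(a_i,a_j)$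 iff $\bar E_{j,i}=1$. A cycle in a digraph is a directed path from $v_1$ to $v_k$ with all vertices distinct, together with an edge from $v_k$ to $v_1$. A subgraph spans a digraph if it has the same vertex set; a digraph is spanned by cycles if it contains cycles whose union is a spanning subgraph, so that every vertex belongs to a cycle.
   Formalization: "Spanned by cycles" is taken to mean spanned by pairwise vertex-disjoint cycles; if cycles may overlap the claim is false (e.g. r=3 with cycles a1-a2 and a1-a3, A'=0, B'=(1,0)^T, H with only H_{2,1}=1). *)

theory Defs
  imports
    "HOL-Analysis.Analysis"
    "HOL-Library.Z2"
    "Graph_Theory.Digraph_Component"
begin

text \<open>
  Binary matrices have entries in \<^typ>\<open>bit\<close>. Their sum is the entrywise logical OR and not
  the sum of \<^typ>\<open>bit\<close>, which is exclusive or.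
\<close>

definition mat_or :: "bit ^ 'n ^ 'm \<Rightarrow> bit ^ 'n ^ 'm \<Rightarrow> bit ^ 'n ^ 'm" (infixl "\<or>\<^sub>M" 65) where
  "P \<or>\<^sub>M Q = (\<chi> i j. Bit_Operations.or (P $ i $ j) (Q $ i $ j))"

text \<open>
  The block structure of a Kronecker product is kept in the index type: row \<open>(i, k)\<close> is row \<open>k\<close>
  of block row \<open>i\<close>.
\<close>

definition kronecker ::
  "'a::times ^ 'n ^ 'm \<Rightarrow> 'a ^ 'q ^ 'p \<Rightarrow> 'a ^ ('n \<times> 'q) ^ ('m \<times> 'p)" (infixl "\<otimes>\<^sub>K" 70) where
  "P \<otimes>\<^sub>K Q = (\<chi> i j. P $ fst i $ fst j * Q $ snd i $ snd j)"

text \<open>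
  Controllability of \<open>x' = M x + N u\<close>: every initial state can be steered to every final state in
  finite time, by a continuous input.
\<close>

definition controllable :: "real ^ 'n ^ 'n \<Rightarrow> real ^ 'p ^ 'n \<Rightarrow> bool" where
  "controllable M N \<longleftrightarrow>
    (\<forall>x0 x1. \<exists>T>0. \<exists>(u :: real \<Rightarrow> real ^ 'p) (x :: real \<Rightarrow> real ^ 'n).
      continuous_on {0..T} u \<and>
      (\<forall>t\<in>{0..T}. (x has_vector_derivative (M *v x t + N *v u t)) (at t within {0..T})) \<and>
      x 0 = x0 \<and> x T = x1)"

definition same_sparsity :: "real ^ 'n ^ 'm \<Rightarrow> bit ^ 'n ^ 'm \<Rightarrow> bool" where
  "same_sparsity M P \<longleftrightarrow> (\<forall>i j. M $ i $ j = 0 \<longleftrightarrow> P $ i $ j = 0)"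

definition structurally_controllable :: "bit ^ 'n ^ 'n \<Rightarrow> bit ^ 'p ^ 'n \<Rightarrow> bool" where
  "structurally_controllable P Q \<longleftrightarrow>
    (\<exists>M N. controllable M N \<and> same_sparsity M P \<and> same_sparsity N Q)"

text \<open>
  The entry \<open>E $ j $ i\<close> says whether subsystem \<open>i\<close> feeds into subsystem \<open>j\<close>, so arcs run from
  column index to row index.
\<close>

definition condensed_graph :: "bit ^ 'r ^ 'r \<Rightarrow> 'r pair_pre_digraph" where
  "condensed_graph E = \<lparr> pverts = UNIV, parcs = {(i, j). E $ j $ i = 1} \<rparr>"

text \<open>On a cycle, every vertex is the tail of exactly one arc.\<close>

definition cycle_graph :: "('a, 'b) pre_digraph \<Rightarrow> 'b awalk \<Rightarrow> ('a, 'b) pre_digraph" where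
  "cycle_graph G c = \<lparr> verts = tail G ` set c, arcs = set c, tail = tail G, head = head G \<rparr>"

text \<open>
  The spanning subgraph is a disjoint union of cycles: distinct cycles of the family share no
  vertex. Without this, the condition would only say that every vertex lies on some cycle, and
  that does not make the composed system structurally controllable. For instance, let a subsystem
  \<open>1\<close> be joined by arcs in both directions to each of \<open>2\<close> and \<open>3\<close>, and let every subsystem have
  two states and one input with \<open>A' = 0\<close>, \<open>B' = (1, 0)\<close> and \<open>H\<close> having a single nonzero entry, from
  the first state to the second. Then the rows of \<open>A\<close> of the second states of \<open>2\<close> and \<open>3\<close> have
  their only nonzero entry in the same column and the corresponding rows of \<open>B\<close> vanish, although
  \<open>(A' \<or>\<^sub>M H, B')\<close> is structurally controllable.
\<close>

definition spanned_by_cycles :: "('a, 'b) pre_digraph \<Rightarrow> bool" where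
  "spanned_by_cycles G \<longleftrightarrow>
    (\<exists>C. (\<forall>c\<in>C. pre_digraph.cycle G c) \<and>
         pairwise (\<lambda>c d. disjnt (verts (cycle_graph G c)) (verts (cycle_graph G d))) C \<and>
         spanning (pre_digraph.Union G (cycle_graph G ` C)) G)"

end

theory Submission
  imports
    Defs
    "HOL-Computational_Algebra.Polynomial_Factorial"
    "HOL-Computational_Algebra.Field_as_Ring"
begin

text \<open>
  Structural controllability can be tested on any controllable real pair whose nonzero entries lie
  within the pattern. By Kalman's criterion (\<open>controllable_iff_kalman\<close>) a pair is
  controllable iff the vectors \<open>M\<^sup>k N e\<^sub>j\<close> span the state space. Along a line in the space of pairs this
  is implied by the nonvanishing of a determinant that is polynomial in the parameter, so if it holds
  at one point, it holds at all but finitely many (\<open>finite_not_kalman\<close>). The missing entries can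
  therefore be made nonzero by a perturbation (\<open>structurally_controllable_if_kalman\<close>).

  It remains to find one such pair for the composed system. Disjoint cycles that span the condensed
  graph are a permutation \<open>\<sigma>\<close> of the subsystems all of whose arcs \<open>(i, \<sigma> i)\<close> are present
  (\<open>spanned_by_cycles_imp_permutation\<close>). Let \<open>(M, N)\<close> be controllable with the pattern of
  \<open>(A' \<or>\<^sub>M H, B')\<close> and split \<open>M = M1 + M2\<close> with \<open>M1\<close> supported in \<open>A'\<close> and \<open>M2\<close> in \<open>H\<close>. With \<open>P\<close> the
  permutation matrix of \<open>\<sigma>\<close> and \<open>c\<close> a real number, take the state matrix
  \<open>(mat 1 \<otimes>\<^sub>K M1) + (c P \<otimes>\<^sub>K M2)\<close> and the input matrix \<open>mat 1 \<otimes>\<^sub>K N\<close>. Over the complex numbers \<open>P\<close> has a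
  basis of eigenvectors, and in this basis the system decouples into the systems
  \<open>(M1 + z M2, N)\<close>, where \<open>z\<close> runs through the eigenvalues of \<open>c P\<close>
  (\<open>kalman_kronecker\<close>). For \<open>z = 1\<close> the Kalman condition holds, so it fails for finitely many \<open>z\<close>
  only. Since every eigenvalue of \<open>c P\<close> has modulus \<open>c\<close>, a large \<open>c\<close> avoids all of them
  (\<open>kalman_permutation_coupling\<close>).
\<close>

section \<open>The Kalman condition\<close>

definition krylov :: "'a::field ^ 'n ^ 'n \<Rightarrow> 'a ^ 'p ^ 'n \<Rightarrow> ('a ^ 'n) set" where
  "krylov M N = {((*v) M ^^ k) (column j N) | k j. True}"

text \<open>
  Over an arbitrary field, since the eigenvectors that decouple the composed system are complex
  while the systems themselves are real. The span takes the place of the usual rank of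
  \<open>[N, M N, \<dots>, M\<^sup>n\<^sup>-\<^sup>1 N]\<close>; letting the exponents be arbitrary makes it \<open>M\<close>-invariant by construction.
\<close>

definition kalman :: "'a::field ^ 'n ^ 'n \<Rightarrow> 'a ^ 'p ^ 'n \<Rightarrow> bool" where
  "kalman M N \<longleftrightarrow> vec.span (krylov M N) = UNIV"

lemma column_in_span_krylov: "column j N \<in> vec.span (krylov M N)"
  by (rule vec.span_base) (auto simp: krylov_def intro!: exI[of _ 0])

lemma span_krylov_invariant:
  assumes "x \<in> vec.span (krylov M N)"
  shows "M *v x \<in> vec.span (krylov M N)"
proof -
  have "(*v) M ` krylov M N \<subseteq> krylov M N"
  proof clarify
    fix y assume "y \<in> krylov M N"
    then obtain k j where "y = ((*v) M ^^ k) (column j N)"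
      by (auto simp: krylov_def)
    then have "M *v y = ((*v) M ^^ Suc k) (column j N)"
      by simp
    then show "M *v y \<in> krylov M N"
      unfolding krylov_def by blast
  qed
  moreover have "(*v) M ` vec.span (krylov M N) = vec.span ((*v) M ` krylov M N)"
    by (simp add: vec.linear_span_image)
  ultimately show ?thesis
    using assms vec.span_mono by blast
qed

text \<open>
  Kalman's condition as an induction principle: the Krylov span is the least \<open>M\<close>-invariant subspace
  that contains the columns of \<open>N\<close>.
\<close>

lemma kalman_subspaceI:
  assumes K: "kalman M N" and S: "vec.subspace S" and c: "\<And>j. column j N \<in> S"
    and i: "\<And>x. x \<in> S \<Longrightarrow> M *v x \<in> S"
  shows "S = UNIV"
proof -
  have "((*v) M ^^ k) (column j N) \<in> S" for k j
    by (induction k) (simp_all add: c i)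
  then have "krylov M N \<subseteq> S"
    by (auto simp: krylov_def)
  then have "vec.span (krylov M N) \<subseteq> S"
    using S by (simp add: vec.span_minimal)
  with K show ?thesis
    by (auto simp: kalman_def)
qed

section \<open>Kalman's criterion for controllability\<close>

text \<open>
  A vector \<open>v\<close> orthogonal to the Krylov span turns the trajectory into scalars
  \<open>y k t = v \<bullet> M\<^sup>k (x t)\<close> that satisfy the uncontrolled chain \<open>y k' = y (k + 1)\<close>. If the trajectory
  starts at \<open>0\<close>, all derivatives of \<open>y 0\<close> vanish at time \<open>0\<close>, and they grow at most geometrically, so
  Taylor's theorem gives \<open>y 0 = 0\<close>. The trajectory can therefore not end at \<open>v\<close>.
\<close>

lemma controllable_imp_kalman:
  fixes M :: "real ^ 'n ^ 'n" and N :: "real ^ 'p ^ 'n"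
  assumes "controllable M N"
  shows "kalman M N"
proof (rule ccontr)
  assume "\<not> kalman M N"
  then have "span (krylov M N) \<noteq> UNIV"
    by (simp add: kalman_def span_vec_eq)
  then obtain v where v: "v \<noteq> 0" "\<And>x. x \<in> span (krylov M N) \<Longrightarrow> v \<bullet> x = 0"
    using span_not_UNIV_orthogonal by blast
  obtain T u x where T: "T > 0"
    and x': "\<And>t. t \<in> {0..T} \<Longrightarrow>
        (x has_vector_derivative (M *v x t + N *v u t)) (at t within {0..T})"
    and x0: "x 0 = 0" and xT: "x T = v"
    using assms unfolding controllable_def by metis
  define y where "y k t = v \<bullet> ((*v) M ^^ k) (x t)" for k t
  have lin: "linear ((*v) M ^^ k)" for k
  proof (induction k)
    case (Suc k)
    from linear_compose[OF Suc matrix_vector_mul_linear[of M]] show ?case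
      by (simp add: comp_def)
  qed (simp add: linear_id[unfolded id_def] id_def)
  have vN: "v \<bullet> ((*v) M ^^ k) (N *v w) = 0" for k w
  proof -
    have "((*v) M ^^ k) (N *v w) = (\<Sum>j\<in>UNIV. w $ j *\<^sub>R ((*v) M ^^ k) (column j N))"
      by (simp add: matrix_mult_sum scalar_mult_eq_scaleR linear_sum[OF lin]
          linear_cmul[OF lin])
    also have "\<dots> \<in> span (krylov M N)"
      by (intro span_sum span_scale span_base) (auto simp: krylov_def)
    finally show ?thesis
      by (rule v(2))
  qed
  have y': "(y k has_field_derivative y (Suc k) t) (at t within {0..T})"
    if "t \<in> {0..T}" for k t
  proof -
    have bl: "bounded_linear (\<lambda>z. v \<bullet> ((*v) M ^^ k) z)"
      by (intro bounded_linear_inner_right_comp linear_conv_bounded_linear[THEN iffD1] lin)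
    have "(y k has_vector_derivative v \<bullet> ((*v) M ^^ k) (M *v x t + N *v u t))
        (at t within {0..T})"
      unfolding y_def using bounded_linear.has_vector_derivative[OF bl x'[OF that]] .
    also have "v \<bullet> ((*v) M ^^ k) (M *v x t + N *v u t) = y (Suc k) t"
      by (simp add: y_def linear_add[OF lin] inner_add_right vN funpow_swap1)
    finally show ?thesis
      by (simp add: has_real_derivative_iff_has_vector_derivative)
  qed
  obtain L where L: "L > 0" "\<And>z. norm (M *v z) \<le> norm z * L"
    using bounded_linear.pos_bounded[OF matrix_vector_mul_bounded_linear[of M]] by blast
  have "continuous_on {0..T} x"
    using x' has_vector_derivative_continuous continuous_on_eq_continuous_within by blast
  then have "bounded (x ` {0..T})"
    by (intro compact_imp_bounded compact_continuous_image) auto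
  then obtain C where C: "C > 0" "\<And>t. t \<in> {0..T} \<Longrightarrow> norm (x t) \<le> C"
    by (auto simp: bounded_pos)
  have pow: "norm (((*v) M ^^ k) z) \<le> L ^ k * norm z" for k z
  proof (induction k)
    case (Suc k)
    have "norm (((*v) M ^^ Suc k) z) \<le> norm (((*v) M ^^ k) z) * L"
      using L(2) by simp
    also have "\<dots> \<le> L ^ k * norm z * L"
      using Suc L(1) by (simp add: mult_right_mono)
    finally show ?case
      by (simp add: mult_ac)
  qed simp
  have bound: "norm (y k t) \<le> norm v * C * L ^ k" if "t \<in> {0..T}" for k t
  proof -
    have "norm (y k t) \<le> norm v * norm (((*v) M ^^ k) (x t))"
      unfolding y_def real_norm_def by (rule Cauchy_Schwarz_ineq2)
    also have "\<dots> \<le> norm v * (L ^ k * C)"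
      using pow[of k "x t"] C(2)[OF that] L(1)
      by (intro mult_left_mono order.trans[OF pow]) auto
    finally show ?thesis
      by (simp add: mult_ac)
  qed
  have y0: "y k 0 = 0" for k
    by (simp add: y_def x0 linear_0[OF lin])
  have "norm (y 0 T) \<le> norm v * C * (L * T) * ((L * T) ^ n / fact n)" for n
  proof -
    have "norm (y 0 T - (\<Sum>i\<le>n. y i 0 * (T - 0) ^ i / fact i))
        \<le> norm v * C * L ^ Suc n * norm (T - 0) ^ Suc n / fact n"
      using T by (intro field_Taylor[of "{0..T}"] y' bound) auto
    then show ?thesis
      using T by (simp add: y0 power_mult_distrib mult_ac)
  qed
  moreover have "(\<lambda>n. norm v * C * (L * T) * ((L * T) ^ n / fact n)) \<longlonglongrightarrow> 0"
    using summable_LIMSEQ_zero[OF summable_exp[of "L * T"]]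
    by (intro tendsto_mult_right_zero) (simp add: field_simps)
  ultimately have "norm (y 0 T) \<le> 0"
    by (meson LIMSEQ_le_const)
  then show False
    using v(1) inner_gt_zero_iff[of v] by (simp add: y_def xT del: inner_gt_zero_iff)
qed

text \<open>
  In the converse direction, discrete paths are turned into continuous trajectories. A path of the
  discrete-time system \<open>\<zeta> (k + 1) = M (\<zeta> k) + N (\<kappa> k)\<close> that starts at \<open>0\<close> and returns to \<open>0\<close>
  after \<open>K\<close> steps yields for every smooth scalar function \<open>\<phi>\<close> the continuous-time trajectory
  \<open>x t = (\<Sum>k<K. \<phi>\<^sup>(\<^sup>K\<^sup>-\<^sup>k\<^sup>) t *\<^sub>R \<zeta> k)\<close> with the corresponding sum over \<open>\<kappa>\<close> as its input:
  differentiating shifts the index by one, exactly as a step of the path does. If the path passes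
  through \<open>y\<close> at step \<open>m\<close>, it remains to choose \<open>\<phi>\<close> such that at the final time its derivative of
  order \<open>K - m\<close> is \<open>1\<close>, while the other derivatives of order below \<open>K\<close> vanish there and all of them
  vanish at the initial time; the derivative of order \<open>K\<close> enters with the factor \<open>\<zeta> 0 = 0\<close>.
\<close>

primrec discrete_state :: "real ^ 'n ^ 'n \<Rightarrow> real ^ 'p ^ 'n \<Rightarrow> (nat \<Rightarrow> real ^ 'p) \<Rightarrow> nat \<Rightarrow> real ^ 'n"
  where
    "discrete_state M N \<eta> 0 = 0"
  | "discrete_state M N \<eta> (Suc k) = M *v discrete_state M N \<eta> k + N *v \<eta> k"

lemma discrete_state_linear:
  "discrete_state M N (\<lambda>i. a *\<^sub>R \<eta> i + b *\<^sub>R \<theta> i) k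
    = a *\<^sub>R discrete_state M N \<eta> k + b *\<^sub>R discrete_state M N \<theta> k"
  by (induction k) (simp_all add: algebra_simps matrix_vector_mult_scaleR)

lemma discrete_state_delay:
  "discrete_state M N (case_nat 0 \<eta>) (Suc k) = discrete_state M N \<eta> k"
  by (induction k) simp_all

lemma discrete_state_impulse:
  "discrete_state M N (\<lambda>i. if i = 0 then axis j 1 else 0) (Suc k)
    = ((*v) M ^^ k) (column j N)"
  by (induction k) (simp_all add: matrix_vector_mult_basis)

lemma discrete_state_append:
  "discrete_state M N (\<lambda>i. if i < m then \<eta> i else \<theta> (i - m)) (m + k)
    = ((*v) M ^^ k) (discrete_state M N \<eta> m) + discrete_state M N \<theta> k"
proof (induction k)
  case 0
  have "discrete_state M N (\<lambda>i. if i < m then \<eta> i else \<theta> (i - m)) l = discrete_state M N \<eta> l"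
    if "l \<le> m" for l
    using that by (induction l) simp_all
  then show ?case by simp
next
  case (Suc k)
  then show ?case by (simp add: matrix_vector_right_distrib)
qed

text \<open>
  The sets of states reachable in \<open>m\<close> steps form an increasing chain of subspaces whose union is
  everything. A number of steps that suffices for each of the finitely many basis vectors suffices
  for all states. A number common to all states matters because a path is later steered to \<open>- M\<^sup>m y\<close> in
  precisely the \<open>m\<close> steps that \<open>y\<close> takes to evolve to \<open>M\<^sup>m y\<close>.
\<close>

lemma kalman_imp_uniformly_reachable:
  fixes M :: "real ^ 'n ^ 'n" and N :: "real ^ 'p ^ 'n"
  assumes "kalman M N"
  obtains m where "m > 0" "\<And>y. \<exists>\<eta>. discrete_state M N \<eta> m = y"
proof -
  define R where "R m = range (\<lambda>\<eta>. discrete_state M N \<eta> m)" for m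
  have lin: "a *\<^sub>R x + b *\<^sub>R y \<in> R m" if "x \<in> R m" "y \<in> R m" for a b x y m
    using that unfolding R_def by (auto simp: discrete_state_linear[symmetric])
  have zero: "0 \<in> R m" for m
    using lin[of "discrete_state M N (\<lambda>_. 0) m" m "discrete_state M N (\<lambda>_. 0) m" 0 0]
    by (simp add: R_def)
  have sub: "subspace (R m)" for m
    using lin[of _ m _ 1 1] lin[of _ m _ _ 0] zero by (simp add: subspace_def)
  have "R m \<subseteq> R (Suc m)" for m
  proof clarify
    fix x assume "x \<in> R m"
    then obtain \<eta> where "x = discrete_state M N \<eta> m"
      by (auto simp: R_def)
    then have "x = discrete_state M N (case_nat 0 \<eta>) (Suc m)"
      by (simp only: discrete_state_delay)
    then show "x \<in> R (Suc m)"
      unfolding R_def by blast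
  qed
  then have mono: "R m \<subseteq> R m'" if "m \<le> m'" for m m'
    using that by (rule lift_Suc_mono_le[of R])
  have "(\<Union>m. R m) = UNIV"
  proof (rule kalman_subspaceI[OF assms])
    show "vec.subspace (\<Union>m. R m)"
      unfolding subspace_vec_eq subspace_def
    proof (intro conjI ballI allI)
      fix x y assume "x \<in> (\<Union>m. R m)" "y \<in> (\<Union>m. R m)"
      then obtain m m' where "x \<in> R m" "y \<in> R m'" by auto
      then have "x \<in> R (max m m')" "y \<in> R (max m m')"
        using mono[of m "max m m'"] mono[of m' "max m m'"] by auto
      then show "x + y \<in> (\<Union>m. R m)"
        using subspace_add[OF sub] by blast
    next
      fix c x assume "x \<in> (\<Union>m. R m)"
      then show "c *\<^sub>R x \<in> (\<Union>m. R m)"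
        using subspace_scale[OF sub] by blast
    qed (use zero in auto)
  next
    fix j
    have "column j N = discrete_state M N (\<lambda>i. if i = 0 then axis j 1 else 0) (Suc 0)"
      by (simp only: discrete_state_impulse funpow_0)
    then show "column j N \<in> (\<Union>m. R m)"
      unfolding R_def by blast
  next
    fix x assume "x \<in> (\<Union>m. R m)"
    then obtain m \<eta> where "x = discrete_state M N \<eta> m"
      by (auto simp: R_def)
    then have "M *v x = discrete_state M N (\<eta>(m := 0)) (Suc m)"
    proof -
      have "discrete_state M N (\<eta>(m := 0)) l = discrete_state M N \<eta> l" if "l \<le> m" for l
        using that by (induction l) auto
      with \<open>x = _\<close> show ?thesis by simp
    qed
    then show "M *v x \<in> (\<Union>m. R m)"
      unfolding R_def by blast
  qed
  then have "\<forall>b. \<exists>m. b \<in> R m" by auto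
  then obtain m where m: "\<And>b. b \<in> R (m b)" by metis
  define k where "k = Suc (Max (m ` Basis))"
  have "b \<in> R k" if "b \<in> Basis" for b
  proof -
    have "m b \<le> Max (m ` Basis)"
      using that by simp
    then show ?thesis
      using mono[of "m b" k] m[of b] by (auto simp: k_def)
  qed
  then have "span Basis \<subseteq> R k"
    by (intro span_minimal sub) auto
  then have "R k = UNIV"
    by auto
  then have "\<exists>\<eta>. discrete_state M N \<eta> k = y" for y
    using rangeE[of y "\<lambda>\<eta>. discrete_state M N \<eta> k"] by (auto simp: R_def)
  then show thesis
    using that[of k] by (simp add: k_def)
qed

lemma poly_higher_pderiv_eq_0:
  fixes p :: "'a::idom poly"
  assumes "[:-a, 1:] ^ K dvd p" "j < K"
  shows "poly ((pderiv ^^ j) p) a = 0"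
  using assms
proof (induction j arbitrary: p K)
  case 0
  then have "[:-a, 1:] dvd p"
    by (meson dvd_power dvd_trans)
  then show ?case
    by (simp add: poly_eq_0_iff_dvd)
next
  case (Suc j)
  then obtain K' where K': "K = Suc K'" "j < K'"
    by (cases K) auto
  with Suc.prems obtain q where "p = [:-a, 1:] ^ Suc K' * q"
    by auto
  then have "pderiv p = [:-a, 1:] ^ K' * (smult (of_nat (Suc K')) q + [:-a, 1:] * pderiv q)"
    by (simp add: pderiv_mult pderiv_power_Suc pderiv_pCons algebra_simps del: of_nat_Suc power_Suc)
      (simp add: algebra_simps)
  then have "[:-a, 1:] ^ K' dvd pderiv p"
    by simp
  from Suc.IH[OF this K'(2)] show ?case
    by (simp add: funpow_swap1)
qed

lemma poly_higher_pderiv_power: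
  fixes a :: "'a::field_char_0"
  shows "poly ((pderiv ^^ j) (smult (1 / fact m) ([:-a, 1:] ^ m))) a = (if j = m then 1 else 0)"
proof (induction j arbitrary: m)
  case 0
  show ?case by (cases m) simp_all
next
  case (Suc j)
  show ?case
  proof (cases m)
    case 0
    have "(pderiv ^^ j) 0 = (0 :: 'a poly)"
      by (induction j) simp_all
    then show ?thesis
      by (simp add: 0 funpow_swap1 pderiv_smult del: funpow.simps add: funpow_Suc_right)
  next
    case (Suc m')
    have "pderiv (smult (1 / fact m) ([:-a, 1:] ^ m)) = smult (1 / fact m') ([:-a, 1:] ^ m')"
      by (simp add: Suc pderiv_smult pderiv_power_Suc pderiv_pCons field_simps
          del: of_nat_Suc power_Suc)
    then show ?thesis
      using Suc.IH[of m'] Suc by (simp add: funpow_Suc_right del: funpow.simps)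
  qed
qed

lemma higher_pderiv_add:
  "(pderiv ^^ j) (p + q) = (pderiv ^^ j) p + (pderiv ^^ j) (q :: 'a::idom poly)"
  by (induction j) (simp_all add: pderiv_add)

text \<open>
  The powers \<open>(X - a)\<^sup>K\<close> and \<open>(X - b)\<^sup>K\<close> are coprime, so a Bezout identity provides a polynomial
  that is \<open>0\<close> modulo the first and \<open>1\<close> modulo the second. Multiplying it by \<open>(X - b)\<^sup>m / m!\<close> gives
  the required derivatives.
\<close>

lemma hermite_interpolation:
  fixes a b :: real
  assumes "a \<noteq> b"
  obtains \<phi> :: "real poly" where
    "\<And>j. j < K \<Longrightarrow> poly ((pderiv ^^ j) \<phi>) a = 0"
    "\<And>j. j < K \<Longrightarrow> poly ((pderiv ^^ j) \<phi>) b = (if j = m then 1 else 0)"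
proof -
  let ?A = "[:-a, 1:] ^ K" and ?B = "[:-b, 1:] ^ K"
  have "coprime [:-a, 1:] [:-b, 1:]"
  proof (rule coprimeI)
    fix d assume "d dvd [:-a, 1:]" "d dvd [:-b, 1:]"
    then have "d dvd [:-a, 1:] - [:-b, 1:]"
      by (rule dvd_diff)
    moreover have "[:-a, 1:] - [:-b, 1:] = [:b - a:]"
      by simp
    moreover have "[:b - a:] dvd 1"
      using assms by (auto simp: is_unit_const_poly_iff dvd_field_iff)
    ultimately show "d dvd 1"
      using dvd_trans by metis
  qed
  then have "coprime ?A ?B"
    by simp
  then obtain u w where uw: "u * ?A + w * ?B = 1"
    by (metis bezout_coefficients_fst_snd coprime_imp_gcd_eq_1)
  let ?\<psi> = "smult (1 / fact m) ([:-b, 1:] ^ m)"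
  define \<phi> where "\<phi> = ?\<psi> * (u * ?A)"
  have "?\<psi> * (u * ?A) + ?\<psi> * (w * ?B) = ?\<psi>"
    unfolding distrib_left[symmetric] uw by simp
  then have \<phi>: "\<phi> = ?\<psi> + ?B * (- ?\<psi> * w)"
    unfolding \<phi>_def by (simp add: algebra_simps)
  show thesis
  proof
    fix j assume j: "j < K"
    show "poly ((pderiv ^^ j) \<phi>) a = 0"
      unfolding \<phi>_def using j
      by (intro poly_higher_pderiv_eq_0[where K = K] dvd_mult dvd_triv_right) auto
    have "poly ((pderiv ^^ j) (?B * (- ?\<psi> * w))) b = 0"
      using j by (intro poly_higher_pderiv_eq_0[where K = K] dvd_triv_left) auto
    then show "poly ((pderiv ^^ j) \<phi>) b = (if j = m then 1 else 0)"
      unfolding \<phi> higher_pderiv_add poly_add poly_higher_pderiv_power by simp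
  qed
qed

text \<open>
  Stated for arbitrary \<open>a \<noteq> b\<close> because with \<open>a > b\<close> it provides a trajectory that ends at \<open>0\<close>.
\<close>

lemma kalman_imp_steerable:
  fixes M :: "real ^ 'n ^ 'n" and N :: "real ^ 'p ^ 'n" and a b :: real
  assumes "kalman M N" "a \<noteq> b"
  obtains x u where "continuous_on UNIV u"
    "\<And>t. (x has_vector_derivative (M *v x t + N *v u t)) (at t)" "x a = 0" "x b = y"
proof -
  obtain m where m: "m > 0" "\<And>y. \<exists>\<eta>. discrete_state M N \<eta> m = y"
    using kalman_imp_uniformly_reachable[OF assms(1)] by blast
  obtain \<eta> where \<eta>: "discrete_state M N \<eta> m = y"
    using m(2) by blast
  obtain \<theta> where \<theta>: "discrete_state M N \<theta> m = - ((*v) M ^^ m) y"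
    using m(2) by blast
  \<comment> \<open>First drive \<open>0\<close> to \<open>y\<close>, then cancel its free evolution.\<close>
  define \<kappa> where "\<kappa> i = (if i < m then \<eta> i else \<theta> (i - m))" for i
  define \<zeta> where "\<zeta> = discrete_state M N \<kappa>"
  define K where "K = m + m"
  have \<zeta>0: "\<zeta> 0 = 0" and \<zeta>Suc: "\<And>k. \<zeta> (Suc k) = M *v \<zeta> k + N *v \<kappa> k"
    by (simp_all add: \<zeta>_def)
  have \<zeta>m: "\<zeta> m = y" and \<zeta>K: "\<zeta> K = 0"
    using discrete_state_append[of M N m \<eta> \<theta> 0] discrete_state_append[of M N m \<eta> \<theta> m] \<eta> \<theta>
    by (simp_all add: \<zeta>_def \<kappa>_def[abs_def] K_def)
  obtain \<phi> :: "real poly" where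
    \<phi>: "\<And>j. j < K \<Longrightarrow> poly ((pderiv ^^ j) \<phi>) a = 0"
       "\<And>j. j < K \<Longrightarrow> poly ((pderiv ^^ j) \<phi>) b = (if j = m then 1 else 0)"
    using hermite_interpolation[OF assms(2)] by blast
  define D where "D j t = poly ((pderiv ^^ j) \<phi>) t" for j t
  define x where "x t = (\<Sum>k<K. D (K - k) t *\<^sub>R \<zeta> k)" for t
  define u where "u t = (\<Sum>k<K. D (K - k) t *\<^sub>R \<kappa> k)" for t
  show thesis
  proof (rule that[of u x])
    show "continuous_on UNIV u"
      unfolding u_def D_def by (intro continuous_intros)
    fix t
    have D': "((D j) has_field_derivative D (Suc j) t) (at t)" for j
      unfolding D_def by (auto intro: poly_DERIV)
    have "(x has_vector_derivative (\<Sum>k<K. D (Suc (K - k)) t *\<^sub>R \<zeta> k)) (at t)"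
      unfolding x_def
      by (intro has_vector_derivative_sum)
        (auto intro!: derivative_eq_intros D')
    \<comment> \<open>The terms that appear or disappear when the index is shifted vanish since \<open>\<zeta> K = 0\<close> and
      \<open>\<zeta> 0 = 0\<close>.\<close>
    also have "(\<Sum>k<K. D (Suc (K - k)) t *\<^sub>R \<zeta> k) = (\<Sum>k<Suc K. D (Suc K - k) t *\<^sub>R \<zeta> k)"
      by (simp add: \<zeta>K Suc_diff_le)
    also have "\<dots> = (\<Sum>k<K. D (K - k) t *\<^sub>R \<zeta> (Suc k))"
      by (subst sum.lessThan_Suc_shift) (simp add: \<zeta>0)
    also have "\<dots> = M *v x t + N *v u t"
      by (simp add: x_def u_def \<zeta>Suc sum.distrib
          scaleR_add_right matrix_vector_mult_scaleR linear_sum[OF matrix_vector_mul_linear])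
    finally show "(x has_vector_derivative (M *v x t + N *v u t)) (at t)" .
  next
    have "D (K - k) a *\<^sub>R \<zeta> k = 0" if "k < K" for k
      using that \<phi>(1)[of "K - k"] \<zeta>0 by (cases "k = 0") (auto simp: D_def)
    then show "x a = 0"
      unfolding x_def by (intro sum.neutral) auto
    have "D (K - k) b *\<^sub>R \<zeta> k = (if k = m then y else 0)" if "k < K" for k
      using that \<phi>(2)[of "K - k"] \<zeta>0 \<zeta>m m(1) by (cases "k = 0") (auto simp: D_def K_def)
    then have "x b = (\<Sum>k<K. if k = m then y else 0)"
      unfolding x_def by (intro sum.cong) auto
    then show "x b = y"
      using m(1) by (simp add: K_def)
  qed
qed

lemma controllable_iff_kalman: "controllable M N \<longleftrightarrow> kalman M N"
proof
  assume K: "kalman M N"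
  show "controllable M N"
    unfolding controllable_def
  proof (intro allI)
    fix y0 y1
    obtain x u where 1: "continuous_on UNIV u"
      "\<And>t. (x has_vector_derivative (M *v x t + N *v u t)) (at t)" "x 0 = 0" "x 1 = y1"
      using kalman_imp_steerable[OF K, of 0 1 y1] by (metis zero_neq_one)
    obtain x' u' where 2: "continuous_on UNIV u'"
      "\<And>t. (x' has_vector_derivative (M *v x' t + N *v u' t)) (at t)" "x' 1 = 0" "x' 0 = y0"
      using kalman_imp_steerable[OF K, of 1 0 y0] by (metis zero_neq_one)
    \<comment> \<open>Superpose a trajectory from \<open>0\<close> to \<open>y1\<close> and one from \<open>y0\<close> to \<open>0\<close>.\<close>
    have "((\<lambda>t. x t + x' t) has_vector_derivative
        (M *v (x t + x' t) + N *v (u t + u' t))) (at t within {0..1})" for t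
      using has_vector_derivative_add[OF 1(2)[of t] 2(2)[of t]]
      by (auto simp: matrix_vector_right_distrib algebra_simps intro: has_vector_derivative_at_within)
    moreover have "continuous_on {0..1} (\<lambda>t. u t + u' t)"
      using 1(1) 2(1) by (intro continuous_on_add) (auto intro: continuous_on_subset)
    ultimately show "\<exists>T>0. \<exists>u x. continuous_on {0..T} u \<and>
        (\<forall>t\<in>{0..T}. (x has_vector_derivative (M *v x t + N *v u t)) (at t within {0..T})) \<and>
        x 0 = y0 \<and> x T = y1"
      using 1(3,4) 2(3,4)
      by (intro exI[of _ 1] conjI exI[of _ "\<lambda>t. u t + u' t"] exI[of _ "\<lambda>t. x t + x' t"]) auto
  qed
qed (rule controllable_imp_kalman)

section \<open>Genericity of the Kalman condition\<close>

definition poly_fun :: "('a::comm_ring_1 \<Rightarrow> 'a) \<Rightarrow> bool" where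
  "poly_fun f \<longleftrightarrow> (\<exists>p. f = poly p)"

lemma poly_fun_const: "poly_fun (\<lambda>z. c)"
  unfolding poly_fun_def by (rule exI[of _ "[:c:]"]) auto

lemma poly_fun_id: "poly_fun (\<lambda>z. z)"
  unfolding poly_fun_def by (rule exI[of _ "[:0, 1:]"]) auto

lemma poly_fun_add:
  assumes "poly_fun f" "poly_fun g"
  shows "poly_fun (\<lambda>z. f z + g z)"
proof -
  obtain p q where "f = poly p" "g = poly q"
    using assms unfolding poly_fun_def by blast
  then have "(\<lambda>z. f z + g z) = poly (p + q)"
    by (simp add: fun_eq_iff)
  then show ?thesis
    unfolding poly_fun_def by blast
qed

lemma poly_fun_mult:
  assumes "poly_fun f" "poly_fun g"
  shows "poly_fun (\<lambda>z. f z * g z)"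
proof -
  obtain p q where "f = poly p" "g = poly q"
    using assms unfolding poly_fun_def by blast
  then have "(\<lambda>z. f z * g z) = poly (p * q)"
    by (simp add: fun_eq_iff)
  then show ?thesis
    unfolding poly_fun_def by blast
qed

lemma poly_fun_sum:
  "(\<And>i. i \<in> I \<Longrightarrow> poly_fun (f i)) \<Longrightarrow> poly_fun (\<lambda>z. \<Sum>i\<in>I. f i z)"
  by (induction I rule: infinite_finite_induct) (simp_all add: poly_fun_const poly_fun_add)

lemma poly_fun_prod:
  "(\<And>i. i \<in> I \<Longrightarrow> poly_fun (f i)) \<Longrightarrow> poly_fun (\<lambda>z. \<Prod>i\<in>I. f i z)"
  by (induction I rule: infinite_finite_induct) (simp_all add: poly_fun_const poly_fun_mult)

lemmas poly_fun_intros =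
  poly_fun_const poly_fun_id poly_fun_add poly_fun_mult poly_fun_sum poly_fun_prod

lemma finite_poly_fun_zeros:
  fixes f :: "'a::idom \<Rightarrow> 'a"
  assumes "poly_fun f" "f z0 \<noteq> 0"
  shows "finite {z. f z = 0}"
  using assms by (auto simp: poly_fun_def intro!: poly_roots_finite)

lemma poly_fun_det:
  fixes W :: "'a::comm_ring_1 \<Rightarrow> 'a ^ 'n ^ 'n"
  assumes "\<And>i j. poly_fun (\<lambda>z. W z $ i $ j)"
  shows "poly_fun (\<lambda>z. det (W z))"
  unfolding det_def using assms by (intro poly_fun_intros)

lemma det_nonzero_iff_span_rows:
  fixes W :: "'a::field ^ 'n ^ 'n"
  shows "det W \<noteq> 0 \<longleftrightarrow> vec.span (rows W) = UNIV"
  unfolding invertible_det_nz[symmetric] invertible_left_inverse matrix_left_invertible_span_rows_gen ..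

text \<open>
  At \<open>z0\<close> some \<open>CARD('n)\<close> vectors \<open>M\<^sup>k N e\<^sub>j\<close> form a basis. The determinant of the vectors with the
  same exponents and column indices is a polynomial in \<open>z\<close> that does not vanish at \<open>z0\<close>, hence it
  has finitely many zeros, and wherever it does not vanish the pair still satisfies the Kalman
  condition.
\<close>

lemma finite_not_kalman:
  fixes M :: "'a::field \<Rightarrow> 'a ^ 'n ^ 'n" and N :: "'a \<Rightarrow> 'a ^ 'p ^ 'n"
  assumes M: "\<And>i j. poly_fun (\<lambda>z. M z $ i $ j)" and N: "\<And>i j. poly_fun (\<lambda>z. N z $ i $ j)"
    and "kalman (M z0) (N z0)"
  shows "finite {z. \<not> kalman (M z) (N z)}"
proof -
  define w where "w z k j = ((*v) (M z) ^^ k) (column j (N z))" for z k j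
  have krylov: "krylov (M z) (N z) = {w z k j | k j. True}" for z
    by (simp add: krylov_def w_def)
  have poly: "poly_fun (\<lambda>z. w z k j $ i)" for k j i
  proof (induction k arbitrary: i)
    case 0
    then show ?case by (simp add: w_def column_def N)
  next
    case (Suc k)
    have "w z (Suc k) j $ i = (\<Sum>l\<in>UNIV. M z $ i $ l * w z k j $ l)" for z
      by (simp add: w_def matrix_vector_mult_def)
    then show ?case
      using Suc by (simp add: poly_fun_sum poly_fun_mult M)
  qed
  have full: "vec.span (krylov (M z0) (N z0)) = UNIV"
    using assms(3) by (simp add: kalman_def)
  obtain B where B: "B \<subseteq> krylov (M z0) (N z0)" "vec.independent B"
      "krylov (M z0) (N z0) \<subseteq> vec.span B" "card B = vec.dim (krylov (M z0) (N z0))"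
    using vec.basis_exists by blast
  have spanB: "vec.span B = UNIV"
    using full B(3) vec.span_minimal[of "krylov (M z0) (N z0)" "vec.span B"] by auto
  have "card B = CARD('n)"
    using B(4) full by (metis vec.dim_span vec_dim_card)
  moreover have "finite B"
    using B(2) vec.finiteI_independent by blast
  ultimately obtain b where b: "bij_betw b (UNIV :: 'n set) B"
    using finite_same_card_bij[of "UNIV :: 'n set" B] by auto
  have "\<forall>i. \<exists>k j. b i = w z0 k j"
    using B(1) b unfolding krylov bij_betw_def by blast
  then obtain k j where kj: "\<And>i. b i = w z0 (k i) (j i)"
    by metis
  define W where "W z = (\<chi> i. w z (k i) (j i))" for z
  have rows: "rows (W z) = range (\<lambda>i. w z (k i) (j i))" for z
    by (auto simp: rows_def row_def W_def)
  have "rows (W z0) = B"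
    using b by (simp add: rows kj[symmetric] bij_betw_def)
  then have "det (W z0) \<noteq> 0"
    by (simp add: det_nonzero_iff_span_rows spanB)
  moreover have "poly_fun (\<lambda>z. det (W z))"
    by (rule poly_fun_det) (simp add: W_def poly)
  ultimately have "finite {z. det (W z) = 0}"
    by (rule finite_poly_fun_zeros[rotated])
  moreover have "kalman (M z) (N z)" if "det (W z) \<noteq> 0" for z
  proof -
    have "rows (W z) \<subseteq> krylov (M z) (N z)"
      by (auto simp: rows krylov)
    then show ?thesis
      using that vec.span_mono unfolding det_nonzero_iff_span_rows kalman_def by blast
  qed
  ultimately show ?thesis
    by (rule_tac finite_subset) auto
qed

text \<open>
  A controllable pair may have zeros where the pattern allows nonzero entries: adding the same number
  \<open>s\<close> to every entry within the pattern preserves the Kalman condition for all but finitely many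
  \<open>s\<close>, and makes all these entries nonzero for all but finitely many \<open>s\<close>.
\<close>

lemma structurally_controllable_if_kalman:
  fixes M :: "real ^ 'n ^ 'n" and N :: "real ^ 'p ^ 'n"
  assumes "kalman M N"
    and M: "\<And>i j. M $ i $ j \<noteq> 0 \<Longrightarrow> P $ i $ j \<noteq> 0"
    and N: "\<And>i j. N $ i $ j \<noteq> 0 \<Longrightarrow> Q $ i $ j \<noteq> 0"
  shows "structurally_controllable P Q"
proof -
  define M' where "M' s = (\<chi> i j. if P $ i $ j \<noteq> 0 then M $ i $ j + s else 0)" for s
  define N' where "N' s = (\<chi> i j. if Q $ i $ j \<noteq> 0 then N $ i $ j + s else 0)" for s
  have "M' 0 = M" "N' 0 = N"
    unfolding M'_def N'_def vec_eq_iff using M N by fastforce+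
  then have "kalman (M' 0) (N' 0)"
    using assms(1) by simp
  moreover have "poly_fun (\<lambda>s. M' s $ i $ j)" for i j
    by (cases "P $ i $ j = 0") (simp_all add: M'_def poly_fun_intros)
  moreover have "poly_fun (\<lambda>s. N' s $ i $ j)" for i j
    by (cases "Q $ i $ j = 0") (simp_all add: N'_def poly_fun_intros)
  ultimately have "finite {s. \<not> kalman (M' s) (N' s)}"
    by (rule finite_not_kalman[rotated 2])
  moreover have "finite (range (\<lambda>(i, j). - M $ i $ j))" "finite (range (\<lambda>(i, j). - N $ i $ j))"
    by simp_all
  ultimately have "finite ({s. \<not> kalman (M' s) (N' s)} \<union> range (\<lambda>(i, j). - M $ i $ j)
      \<union> range (\<lambda>(i, j). - N $ i $ j))"
    by blast
  then obtain s where "s \<notin> {s. \<not> kalman (M' s) (N' s)} \<union> range (\<lambda>(i, j). - M $ i $ j)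
      \<union> range (\<lambda>(i, j). - N $ i $ j)"
    by (rule exE[OF ex_new_if_finite[OF infinite_UNIV_char_0]])
  then have s: "kalman (M' s) (N' s)"
      "s \<notin> range (\<lambda>(i, j). - M $ i $ j)" "s \<notin> range (\<lambda>(i, j). - N $ i $ j)"
    by simp_all
  have "M $ i $ j + s \<noteq> 0" for i j
    using s(2) by (auto simp: image_iff add_eq_0_iff)
  moreover have "N $ i $ j + s \<noteq> 0" for i j
    using s(3) by (auto simp: image_iff add_eq_0_iff)
  ultimately have "same_sparsity (M' s) P" "same_sparsity (N' s) Q"
    by (auto simp: same_sparsity_def M'_def N'_def)
  then show ?thesis
    using s(1) unfolding structurally_controllable_def controllable_iff_kalman by blast
qed

section \<open>Extension of scalars from the reals to the complex numbers\<close>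

definition cvec :: "real ^ 'n \<Rightarrow> complex ^ 'n" where
  "cvec x = (\<chi> i. of_real (x $ i))"

abbreviation cmat :: "real ^ 'n ^ 'm \<Rightarrow> complex ^ 'n ^ 'm" where
  "cmat \<equiv> map_matrix of_real"

lemma cvec_mult: "cmat M *v cvec x = cvec (M *v x)"
  by (simp add: vec_eq_iff cvec_def matrix_vector_mult_def map_matrix_def)

lemma krylov_cmat: "krylov (cmat M) (cmat N) = cvec ` krylov M N"
proof -
  have "((*v) (cmat M) ^^ k) (column j (cmat N)) = cvec (((*v) M ^^ k) (column j N))" for k j
  proof (induction k)
    case 0
    show ?case by (simp add: vec_eq_iff cvec_def column_def map_matrix_def)
  qed (simp add: cvec_mult)
  then show ?thesis
    by (auto simp: krylov_def)
qed

text \<open>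
  From right to left, the real and the imaginary part of a vector lie in the complex span. From left
  to right, taking real and imaginary parts of a complex linear combination of real vectors yields
  real linear combinations.
\<close>

lemma span_cvec_iff:
  "vec.span (cvec ` X) = UNIV \<longleftrightarrow> span X = UNIV"
proof
  assume X: "span X = UNIV"
  let ?S = "{x. cvec x \<in> vec.span (cvec ` X)}"
  have add: "cvec (x + y) = cvec x + cvec y" and scale: "cvec (c *\<^sub>R x) = of_real c *s cvec x"
    for x y and c :: real
    by (simp_all add: cvec_def vec_eq_iff)
  have zero: "cvec 0 = 0"
    by (simp add: cvec_def vec_eq_iff)
  have "subspace ?S"
    by (auto simp: subspace_def add scale zero intro: vec.span_add vec.span_scale vec.span_zero)
  then have "span X \<subseteq> ?S"
    by (intro span_minimal) (auto intro: vec.span_base)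
  then have real: "cvec x \<in> vec.span (cvec ` X)" for x
    using X by auto
  have "z \<in> vec.span (cvec ` X)" for z
  proof -
    have "z = cvec (\<chi> i. Re (z $ i)) + \<i> *s cvec (\<chi> i. Im (z $ i))"
      by (simp add: vec_eq_iff cvec_def complex_eq)
    then show ?thesis
      using real by (metis vec.span_add vec.span_scale)
  qed
  then show "vec.span (cvec ` X) = UNIV"
    by auto
next
  assume X: "vec.span (cvec ` X) = UNIV"
  let ?S = "{z. (\<chi> i. Re (z $ i)) \<in> span X \<and> (\<chi> i. Im (z $ i)) \<in> span X}"
  have "vec.subspace ?S"
    unfolding vec.subspace_def
  proof (intro conjI ballI allI)
    show "0 \<in> ?S"
      using span_zero[of X] by (simp add: zero_vec_def)
  next
    fix x y assume xy: "x \<in> ?S" "y \<in> ?S"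
    have "(\<chi> i. Re ((x + y) $ i)) = (\<chi> i. Re (x $ i)) + (\<chi> i. Re (y $ i))"
      "(\<chi> i. Im ((x + y) $ i)) = (\<chi> i. Im (x $ i)) + (\<chi> i. Im (y $ i))"
      by (simp_all add: vec_eq_iff)
    with xy show "x + y \<in> ?S"
      by (simp only: mem_Collect_eq span_add)
  next
    fix c x assume x: "x \<in> ?S"
    have "(\<chi> i. Re ((c *s x) $ i)) = Re c *\<^sub>R (\<chi> i. Re (x $ i)) - Im c *\<^sub>R (\<chi> i. Im (x $ i))"
      "(\<chi> i. Im ((c *s x) $ i)) = Re c *\<^sub>R (\<chi> i. Im (x $ i)) + Im c *\<^sub>R (\<chi> i. Re (x $ i))"
      by (simp_all add: vec_eq_iff)
    with x show "c *s x \<in> ?S"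
      by (simp only: mem_Collect_eq span_add span_diff span_scale)
  qed
  moreover have "cvec ` X \<subseteq> ?S"
    using span_zero[of X] by (auto simp: cvec_def zero_vec_def intro: span_base)
  ultimately have "vec.span (cvec ` X) \<subseteq> ?S"
    by (simp add: vec.span_minimal)
  then have S: "z \<in> ?S" for z
    using X by auto
  have "x \<in> span X" for x
    using S[of "cvec x"] by (simp add: cvec_def)
  then show "span X = UNIV"
    by auto
qed

lemma kalman_cmat_iff: "kalman (cmat M) (cmat N) \<longleftrightarrow> kalman M N"
  by (simp add: kalman_def krylov_cmat span_cvec_iff span_vec_eq)

section \<open>From spanning cycles to a permutation\<close>

lemma (in pre_digraph) cycle_heads:
  assumes "cycle c"
  shows "inj_on (head G) (set c)" "head G ` set c = tail G ` set c"
    "set c \<subseteq> arcs G"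
proof -
  obtain u where u: "awalk u c u" "distinct (tl (awalk_verts u c))" "c \<noteq> []"
    using assms by (auto simp: cycle_def)
  then have cas: "cas u c u" and arcs: "set c \<subseteq> arcs G"
    by (auto simp: awalk_def)
  have verts: "awalk_verts u c = tail G (hd c) # map (head G) c"
    using awalk_verts_conv'[OF cas] u(3) by simp
  from u(2) show "inj_on (head G) (set c)"
    by (simp add: verts distinct_map)
  show "set c \<subseteq> arcs G"
    by (rule arcs)
  \<comment> \<open>Along a walk the lists of tails and heads differ only in the end points, which agree here.\<close>
  have "mset (map (tail G) c) + {#v#} = mset (map (head G) c) + {#u#}" if "cas u c v" for u v c
    using that by (induction c arbitrary: u) auto
  from this[OF cas] have "mset (map (tail G) c) = mset (map (head G) c)"
    by simp
  then have "set (map (tail G) c) = set (map (head G) c)"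
    by (rule mset_eq_setD)
  then show "head G ` set c = tail G ` set c"
    by simp
qed

text \<open>
  Sending each vertex to its successor on the unique cycle through it is injective: two vertices with
  a common successor lie on the same cycle by disjointness, and no vertex of a cycle is the head of
  two of its arcs.
\<close>

lemma spanned_by_cycles_imp_permutation:
  fixes G :: "('a, 'b) pre_digraph"
  assumes "spanned_by_cycles G" and "finite (verts G)"
  obtains \<sigma> where "bij_betw \<sigma> (verts G) (verts G)"
    "\<And>v. v \<in> verts G \<Longrightarrow> \<exists>e\<in>arcs G. tail G e = v \<and> head G e = \<sigma> v"
proof -
  obtain C where C: "\<And>c. c \<in> C \<Longrightarrow> pre_digraph.cycle G c"
      and disj: "pairwise (\<lambda>c d. disjnt (verts (cycle_graph G c)) (verts (cycle_graph G d))) C"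
      and span: "spanning (pre_digraph.Union G (cycle_graph G ` C)) G"
    using assms(1) unfolding spanned_by_cycles_def by blast
  have verts: "verts G = (\<Union>c\<in>C. tail G ` set c)"
    using span by (simp add: spanning_def pre_digraph.Union_def cycle_graph_def)
  note cyc = pre_digraph.cycle_heads[OF C]
  have same: "c = d" if "c \<in> C" "d \<in> C" "v \<in> tail G ` set c" "v \<in> tail G ` set d" for c d v
    using disj that by (auto simp: pairwise_def cycle_graph_def disjnt_def)
  have "\<forall>v\<in>verts G. \<exists>c e. c \<in> C \<and> e \<in> set c \<and> tail G e = v"
    by (auto simp: verts)
  then obtain c e where ce: "\<And>v. v \<in> verts G \<Longrightarrow> c v \<in> C \<and> e v \<in> set (c v) \<and> tail G (e v) = v"
    by metis
  define \<sigma> where "\<sigma> v = head G (e v)" for v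
  have \<sigma>c: "\<sigma> v \<in> tail G ` set (c v)" if "v \<in> verts G" for v
    using ce[OF that] cyc(2)[of "c v"] by (auto simp: \<sigma>_def)
  have "\<sigma> ` verts G \<subseteq> verts G"
    using \<sigma>c ce unfolding verts by blast
  moreover have "inj_on \<sigma> (verts G)"
  proof (rule inj_onI)
    fix v w assume v: "v \<in> verts G" and w: "w \<in> verts G" and eq: "\<sigma> v = \<sigma> w"
    have cc: "c v = c w"
      using same \<sigma>c[OF v] \<sigma>c[OF w] ce[OF v] ce[OF w] eq by metis
    have "e v = e w"
    proof (rule inj_onD[OF cyc(1)])
      show "c w \<in> C" "e w \<in> set (c w)"
        using ce[OF w] by blast+
      show "e v \<in> set (c w)"
        using ce[OF v] unfolding cc by blast
      show "head G (e v) = head G (e w)"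
        using eq unfolding \<sigma>_def .
    qed
    moreover have "v = tail G (e v)" "w = tail G (e w)"
      using ce[OF v] ce[OF w] by auto
    ultimately show "v = w"
      by metis
  qed
  ultimately have "bij_betw \<sigma> (verts G) (verts G)"
    using assms(2) endo_inj_surj[of "verts G" \<sigma>] by (simp add: bij_betw_def)
  moreover have "\<exists>e\<in>arcs G. tail G e = v \<and> head G e = \<sigma> v" if "v \<in> verts G" for v
    using ce[OF that] cyc(3)[of "c v"] by (auto simp: \<sigma>_def intro!: bexI[of _ "e v"])
  ultimately show thesis
    by (rule that)
qed

section \<open>Decoupling a composed system\<close>

definition tensor :: "'a::times ^ 'r \<Rightarrow> 'a ^ 'n \<Rightarrow> 'a ^ ('r \<times> 'n)" where
  "tensor \<xi> x = (\<chi> q. \<xi> $ fst q * x $ snd q)"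

lemma kronecker_tensor:
  fixes P :: "'a::comm_semiring_1 ^ 'r ^ 's"
  shows "(P \<otimes>\<^sub>K Q) *v tensor \<xi> x = tensor (P *v \<xi>) (Q *v x)"
proof -
  have "(\<Sum>l\<in>UNIV. P $ a $ fst l * Q $ b $ snd l * (\<xi> $ fst l * x $ snd l))
      = (\<Sum>i\<in>UNIV. P $ a $ i * \<xi> $ i) * (\<Sum>j\<in>UNIV. Q $ b $ j * x $ j)" for a b
    unfolding sum_product sum.cartesian_product UNIV_Times_UNIV split_beta
    by (simp only: mult_ac)
  then show ?thesis
    by (simp add: vec_eq_iff tensor_def kronecker_def matrix_vector_mult_def)
qed

lemma column_kronecker: "column (i, j) (P \<otimes>\<^sub>K Q) = tensor (column i P) (column j Q)"
  by (simp add: vec_eq_iff tensor_def kronecker_def column_def)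

lemma column_mat_1: "column i (mat 1) = axis i 1"
  by (simp add: vec_eq_iff column_def mat_def axis_def)

lemma tensor_linear_left:
  fixes \<xi> :: "'a::field ^ 'r"
  shows "Vector_Spaces.linear (*s) (*s) (\<lambda>\<xi>. tensor \<xi> (x :: 'a ^ 'n))"
  by unfold_locales (simp_all add: tensor_def vec_eq_iff algebra_simps)

lemma tensor_linear_right:
  fixes \<xi> :: "'a::field ^ 'r"
  shows "Vector_Spaces.linear (*s) (*s) (\<lambda>x. tensor \<xi> (x :: 'a ^ 'n))"
  by unfold_locales (simp_all add: tensor_def vec_eq_iff algebra_simps)

lemma span_tensor:
  fixes X :: "('a::field ^ 'r) set"
  assumes "vec.span X = UNIV"
  shows "vec.span {tensor \<xi> x | \<xi> (x :: 'a ^ 'n). \<xi> \<in> X} = UNIV"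
proof -
  let ?S = "vec.span {tensor \<xi> x | \<xi> (x :: 'a ^ 'n). \<xi> \<in> X}"
  have t: "tensor \<xi> x \<in> ?S" for \<xi> x
  proof -
    interpret l: Vector_Spaces.linear "(*s)" "(*s)" "\<lambda>\<xi>. tensor \<xi> x"
      by (rule tensor_linear_left)
    have "tensor \<xi> x \<in> (\<lambda>\<xi>. tensor \<xi> x) ` vec.span X"
      using assms by auto
    also have "\<dots> = vec.span ((\<lambda>\<xi>. tensor \<xi> x) ` X)"
      by (rule l.span_image[symmetric])
    also have "\<dots> \<subseteq> ?S"
      by (rule vec.span_mono) auto
    finally show ?thesis .
  qed
  have "y = (\<Sum>i\<in>UNIV. tensor (axis i 1) (\<chi> k. y $ (i, k)))" for y :: "'a ^ ('r \<times> 'n)"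
    by (simp add: vec_eq_iff tensor_def axis_def if_distrib[of "\<lambda>a. a * _"] sum.If_cases
        sum.delta cong: if_cong)
  then have "y \<in> ?S" for y
    by (rule ssubst) (intro vec.span_sum t)
  then show ?thesis
    by auto
qed

text \<open>
  On the subspace of vectors \<open>tensor \<xi> x\<close> with \<open>P \<xi> = \<omega> \<xi>\<close> the composed system acts on the factor
  \<open>x\<close> as the single system \<open>M1 + \<omega> M2\<close>. Because every component has its own copy of the input,
  \<open>tensor \<xi> (N e\<^sub>j)\<close> is available for every \<open>\<xi>\<close>, so each such subspace lies in the Krylov span as
  soon as \<open>(M1 + \<omega> M2, N)\<close> satisfies the Kalman condition.
\<close>

lemma kalman_kronecker:
  fixes P :: "'a::field ^ 'r ^ 'r" and M1 M2 :: "'a ^ 'n ^ 'n" and N :: "'a ^ 'p ^ 'n"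
  assumes X: "vec.span X = UNIV"
    and eig: "\<And>\<xi>. \<xi> \<in> X \<Longrightarrow> \<exists>\<omega>. P *v \<xi> = \<omega> *s \<xi> \<and> kalman (M1 + map_matrix ((*) \<omega>) M2) N"
  shows "kalman ((mat 1 \<otimes>\<^sub>K M1) + (P \<otimes>\<^sub>K M2)) (mat 1 \<otimes>\<^sub>K N)"
    (is "kalman ?M ?N")
proof -
  let ?S = "vec.span (krylov ?M ?N)"
  have "tensor \<xi> x \<in> ?S" if \<xi>: "\<xi> \<in> X" for \<xi> and x :: "'a ^ 'n"
  proof -
    obtain \<omega> where \<omega>: "P *v \<xi> = \<omega> *s \<xi>" "kalman (M1 + map_matrix ((*) \<omega>) M2) N" (is "kalman ?M\<omega> N")
      using eig[OF \<xi>] by (elim exE conjE)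
    interpret r: Vector_Spaces.linear "(*s)" "(*s)" "\<lambda>x :: 'a ^ 'n. tensor \<xi> x"
      by (rule tensor_linear_right)
    have M: "?M *v tensor \<xi> y = tensor \<xi> (?M\<omega> *v y)" for y
    proof -
      have "?M *v tensor \<xi> y = tensor \<xi> (M1 *v y) + tensor (\<omega> *s \<xi>) (M2 *v y)"
        by (simp add: matrix_vector_mult_add_rdistrib kronecker_tensor \<omega>(1))
      also have "tensor (\<omega> *s \<xi>) (M2 *v y) = tensor \<xi> (map_matrix ((*) \<omega>) M2 *v y)"
        by (simp add: vec_eq_iff tensor_def matrix_vector_mult_def map_matrix_def
            sum_distrib_left mult_ac)
      finally show ?thesis
        by (simp add: matrix_vector_mult_add_rdistrib r.add)
    qed
    have N: "tensor \<xi> (column j N) \<in> ?S" for j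
    proof -
      interpret l: Vector_Spaces.linear "(*s)" "(*s)" "\<lambda>\<xi> :: 'a ^ 'r. tensor \<xi> (column j N)"
        by (rule tensor_linear_left)
      have "tensor \<xi> (column j N) = tensor (\<Sum>i\<in>UNIV. \<xi> $ i *s axis i 1) (column j N)"
        by (simp add: basis_expansion)
      also have "\<dots> = (\<Sum>i\<in>UNIV. \<xi> $ i *s tensor (axis i 1) (column j N))"
        by (simp only: l.sum l.scale)
      also have "\<dots> = (\<Sum>i\<in>UNIV. \<xi> $ i *s column (i, j) ?N)"
        by (simp only: column_kronecker column_mat_1)
      also have "\<dots> \<in> ?S"
        by (intro vec.span_sum vec.span_scale column_in_span_krylov)
      finally show ?thesis .
    qed
    have "vec.subspace {y. tensor \<xi> y \<in> ?S}"
      by (auto simp: vec.subspace_def r.add r.scale r.zero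
          intro: vec.span_add vec.span_scale vec.span_zero)
    then have "{y. tensor \<xi> y \<in> ?S} = UNIV"
    proof (rule kalman_subspaceI[OF \<omega>(2)])
      fix y assume "y \<in> {y. tensor \<xi> y \<in> ?S}"
      then show "?M\<omega> *v y \<in> {y. tensor \<xi> y \<in> ?S}"
        using span_krylov_invariant[of "tensor \<xi> y" ?M ?N] by (simp add: M)
    qed (simp add: N)
    then show ?thesis
      by auto
  qed
  then have "vec.span {tensor \<xi> x | \<xi> x. \<xi> \<in> X} \<subseteq> ?S"
    by (intro vec.span_minimal) auto
  then show ?thesis
    unfolding kalman_def span_tensor[OF X] by auto
qed

definition perm_mat :: "('r \<Rightarrow> 'r) \<Rightarrow> 'a::zero_neq_one ^ 'r ^ 'r" where
  "perm_mat \<sigma> = (\<chi> j i. if j = \<sigma> i then 1 else 0)"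

lemma column_eq_mult_axis:
  "column i A = A *v axis i (1 :: 'a::comm_ring_1)"
proof -
  have "A *v axis i 1 = (\<Sum>k\<in>UNIV. if k = i then column k A else 0)"
    unfolding matrix_mult_sum by (rule sum.cong) (auto simp: axis_def)
  then show ?thesis
    by simp
qed

lemma perm_mat_axis:
  "perm_mat \<sigma> *v axis i 1 = axis (\<sigma> i) (1 :: 'a::comm_ring_1)"
  unfolding column_eq_mult_axis[symmetric]
  by (simp add: vec_eq_iff perm_mat_def axis_def column_def)

text \<open>
  If the orbit of \<open>i\<close> closes up after \<open>m\<close> steps, the discrete Fourier transforms of the orbit,
  \<open>\<xi> l = (\<Sum>k<m. \<zeta>\<^sup>l\<^sup>k e (\<sigma>\<^sup>k i))\<close> for a primitive \<open>m\<close>-th root of unity \<open>\<zeta>\<close>, are eigenvectors, and Fourier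
  inversion recovers the unit vector \<open>e\<^sub>i\<close> as their average.
\<close>

lemma span_perm_mat_eigenvectors:
  fixes \<sigma> :: "'r::finite \<Rightarrow> 'r"
  assumes "bij \<sigma>"
  shows "vec.span {\<xi> :: complex ^ 'r. \<exists>\<omega>. norm \<omega> = 1 \<and> perm_mat \<sigma> *v \<xi> = \<omega> *s \<xi>} = UNIV"
    (is "vec.span ?X = UNIV")
proof -
  have "axis i 1 \<in> vec.span ?X" for i
  proof -
    obtain m where m: "m > 0" "(\<sigma> ^^ m) i = i"
      by (rule funpow_inj_finite[OF bij_is_inj[OF assms] finite])
    define \<zeta> where "\<zeta> = cis (- 2 * pi / m)"
    have \<zeta>m: "\<zeta> ^ m = 1"
      using m(1) by (simp add: \<zeta>_def Complex.DeMoivre complex_eq_iff)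
    have \<zeta>k: "\<zeta> ^ k \<noteq> 1" if "0 < k" "k < m" for k
    proof
      assume "\<zeta> ^ k = 1"
      then have "cis (- (2 * pi * k / m)) = 1"
        by (simp add: \<zeta>_def Complex.DeMoivre) (simp add: mult_ac)
      then have "cos (2 * pi * k / m) = 1"
        by (simp add: complex_eq_iff)
      then obtain n :: int where "2 * pi * k / m = n * 2 * pi"
        using cos_one_2pi_int by auto
      then have "real k = real_of_int n * m"
        using m(1) by (simp add: field_simps)
      then have "int k = n * int m"
        by (metis of_int_eq_iff of_int_mult of_int_of_nat_eq)
      then have "m dvd k"
        by (metis dvd_triv_right int_dvd_int_iff)
      with that show False
        by (auto dest: dvd_imp_le)
    qed
    define \<xi> :: "nat \<Rightarrow> complex ^ 'r"
      where "\<xi> l = (\<Sum>k<m. (\<zeta> ^ l) ^ k *s axis ((\<sigma> ^^ k) i) 1)" for l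
    have "\<xi> l \<in> ?X" for l
    proof -
      have \<omega>: "norm (\<zeta> ^ l) = 1" "(\<zeta> ^ l) ^ m = 1" "\<zeta> ^ l \<noteq> 0"
      proof -
        show "norm (\<zeta> ^ l) = 1" "\<zeta> ^ l \<noteq> 0"
          by (simp_all add: \<zeta>_def norm_power)
        have "(\<zeta> ^ l) ^ m = (\<zeta> ^ m) ^ l"
          by (simp add: power_mult[symmetric] mult.commute)
        then show "(\<zeta> ^ l) ^ m = 1"
          by (simp add: \<zeta>m)
      qed
      have "\<zeta> ^ l *s (perm_mat \<sigma> *v \<xi> l) = (\<Sum>k<m. (\<zeta> ^ l) ^ Suc k *s axis ((\<sigma> ^^ Suc k) i) 1)"
        by (simp add: \<xi>_def vec.sum vec.scale perm_mat_axis vec.scale_sum_right)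
      also have "\<dots> = \<xi> l"
      proof -
        have "(\<Sum>k<Suc m. (\<zeta> ^ l) ^ k *s axis ((\<sigma> ^^ k) i) 1) = \<xi> l + axis i (1 :: complex)"
          by (simp add: \<xi>_def \<omega>(2) m(2) del: power_Suc)
        moreover have "(\<Sum>k<Suc m. (\<zeta> ^ l) ^ k *s axis ((\<sigma> ^^ k) i) 1)
            = axis i 1 + (\<Sum>k<m. (\<zeta> ^ l) ^ Suc k *s axis ((\<sigma> ^^ Suc k) i) 1)"
          by (subst sum.lessThan_Suc_shift) simp
        ultimately show ?thesis
          by (simp add: add.commute)
      qed
      finally have "perm_mat \<sigma> *v \<xi> l = inverse (\<zeta> ^ l) *s \<xi> l"
        using \<omega>(3) by (metis vec.scale_scale vec.scale_one left_inverse)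
      moreover have "norm (inverse (\<zeta> ^ l)) = 1"
        using \<omega>(1) by (simp add: norm_inverse)
      ultimately show ?thesis by blast
    qed
    then have "inverse (of_nat m) *s (\<Sum>l<m. \<xi> l) \<in> vec.span ?X"
      by (intro vec.span_scale vec.span_sum vec.span_base)
    also have "inverse (of_nat m) *s (\<Sum>l<m. \<xi> l) = axis i 1"
    proof -
      have geo: "(\<Sum>l<m. (\<zeta> ^ l) ^ k) = (if k = 0 then of_nat m else 0)" if "k < m" for k
      proof (cases "k = 0")
        case False
        have "(\<Sum>l<m. (\<zeta> ^ l) ^ k) = (\<Sum>l<m. (\<zeta> ^ k) ^ l)"
          by (simp add: power_mult[symmetric] mult.commute)
        also have "\<dots> = ((\<zeta> ^ k) ^ m - 1) / (\<zeta> ^ k - 1)"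
          using \<zeta>k[of k] False that by (intro geometric_sum) auto
        also have "(\<zeta> ^ k) ^ m = 1"
          by (metis \<zeta>m mult.commute power_mult power_one)
        finally show ?thesis
          using False by simp
      qed simp
      have "(\<Sum>l<m. \<xi> l) = (\<Sum>k<m. (\<Sum>l<m. (\<zeta> ^ l) ^ k) *s axis ((\<sigma> ^^ k) i) 1)"
        unfolding \<xi>_def by (subst sum.swap) (simp add: vec.scale_sum_left)
      also have "\<dots> = (\<Sum>k<m. if k = 0 then of_nat m *s axis i 1 else 0)"
        by (intro sum.cong) (auto simp: geo)
      also have "\<dots> = of_nat m *s axis i 1"
        using m(1) by simp
      finally show ?thesis
        using m(1) by simp
    qed
    finally show ?thesis .
  qed
  then have "(\<Sum>i\<in>UNIV. x $ i *s axis i 1) \<in> vec.span ?X" for x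
    by (intro vec.span_sum vec.span_scale)
  then have "x \<in> vec.span ?X" for x
    unfolding basis_expansion .
  then show ?thesis
    by auto
qed

section \<open>Coupling along a permutation\<close>

text \<open>
  By hypothesis \<open>M1 + z M2\<close> is good for \<open>z = 1\<close>, hence for all complex \<open>z\<close> outside a finite set. The
  eigenvalues of \<open>c P\<close>, for \<open>P\<close> the permutation matrix, all have modulus \<open>c\<close>, so for large \<open>c\<close> they
  avoid that set and the composed system decouples into good ones. With \<open>c = 1\<close> this can fail:
  nothing prevents another root of unity from being a bad value of \<open>z\<close>.
\<close>

lemma kalman_permutation_coupling:
  fixes M1 M2 :: "real ^ 'n ^ 'n" and N :: "real ^ 'p ^ 'n" and \<sigma> :: "'r::finite \<Rightarrow> 'r"
  assumes "kalman (M1 + M2) N" and "bij \<sigma>"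
  obtains c :: real where
    "kalman ((mat 1 \<otimes>\<^sub>K M1) + (map_matrix ((*) c) (perm_mat \<sigma>) \<otimes>\<^sub>K M2)) (mat 1 \<otimes>\<^sub>K N)"
proof -
  define F where "F z = cmat M1 + map_matrix ((*) z) (cmat M2)" for z
  have "F 1 = cmat (M1 + M2)"
    by (simp add: F_def vec_eq_iff map_matrix_def)
  then have "kalman (F 1) (cmat N)"
    using assms(1) by (simp add: kalman_cmat_iff)
  moreover have "poly_fun (\<lambda>z. F z $ i $ j)" for i j
    by (simp add: F_def map_matrix_def poly_fun_intros)
  moreover have "poly_fun (\<lambda>z. cmat N $ i $ j)" for i j
    by (rule poly_fun_const)
  ultimately have "finite {z. \<not> kalman (F z) (cmat N)}"
    by (rule finite_not_kalman[rotated 2])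
  then have "bounded {z. \<not> kalman (F z) (cmat N)}"
    by (rule finite_imp_bounded)
  then obtain b where b: "\<And>z. \<not> kalman (F z) (cmat N) \<Longrightarrow> norm z \<le> b"
    unfolding bounded_iff by auto
  define c where "c = \<bar>b\<bar> + 1"
  let ?P = "map_matrix ((*) (of_real c)) (perm_mat \<sigma>) :: complex ^ 'r ^ 'r"
  have "kalman ((mat 1 \<otimes>\<^sub>K cmat M1) + (?P \<otimes>\<^sub>K cmat M2)) (mat 1 \<otimes>\<^sub>K cmat N)"
  proof (rule kalman_kronecker[OF span_perm_mat_eigenvectors[OF assms(2)]])
    fix \<xi> :: "complex ^ 'r"
    assume "\<xi> \<in> {\<xi>. \<exists>\<omega>. norm \<omega> = 1 \<and> perm_mat \<sigma> *v \<xi> = \<omega> *s \<xi>}"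
    then obtain \<omega> where \<omega>: "norm \<omega> = 1" "perm_mat \<sigma> *v \<xi> = \<omega> *s \<xi>"
      by blast
    have "?P *v \<xi> = of_real c *s (perm_mat \<sigma> *v \<xi>)"
      by (simp add: vec_eq_iff matrix_vector_mult_def map_matrix_def sum_distrib_left mult_ac)
    then have "?P *v \<xi> = (of_real c * \<omega>) *s \<xi>"
      by (simp add: \<omega>(2))
    moreover have "\<not> norm (of_real c * \<omega>) \<le> b"
      by (simp add: norm_mult \<omega>(1) c_def)
    then have "kalman (F (of_real c * \<omega>)) (cmat N)"
      using b by blast
    ultimately show "\<exists>\<omega>. ?P *v \<xi> = \<omega> *s \<xi> \<and>
        kalman (cmat M1 + map_matrix ((*) \<omega>) (cmat M2)) (cmat N)"
      unfolding F_def by blast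
  qed
  also have "(mat 1 \<otimes>\<^sub>K cmat M1) + (?P \<otimes>\<^sub>K cmat M2)
      = cmat ((mat 1 \<otimes>\<^sub>K M1) + (map_matrix ((*) c) (perm_mat \<sigma>) \<otimes>\<^sub>K M2))"
    by (simp add: vec_eq_iff map_matrix_def kronecker_def mat_def perm_mat_def)
  also have "mat 1 \<otimes>\<^sub>K cmat N = cmat (mat 1 \<otimes>\<^sub>K N)"
    by (simp add: vec_eq_iff map_matrix_def kronecker_def mat_def)
  finally show thesis
    unfolding kalman_cmat_iff by (rule that)
qed

lemma or_bit_eq_0_iff: "Bit_Operations.or a b = 0 \<longleftrightarrow> a = 0 \<and> b = (0 :: bit)"
  by (cases a; cases b) simp_all

theorem theorem3:
  fixes A' :: "bit ^ 'n ^ 'n" and B' :: "bit ^ 'p ^ 'n" and H :: "bit ^ 'n ^ 'n"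
    and E :: "bit ^ 'r ^ 'r"
    and A :: "bit ^ ('r \<times> 'n) ^ ('r \<times> 'n)" and B :: "bit ^ ('r \<times> 'p) ^ ('r \<times> 'n)"
  assumes "\<And>i. E $ i $ i = 0"
    and "A = (mat 1 \<otimes>\<^sub>K A') \<or>\<^sub>M (E \<otimes>\<^sub>K H)"
    and "B = mat 1 \<otimes>\<^sub>K B'"
    and "\<not> structurally_controllable A' B'"
    and "structurally_controllable (A' \<or>\<^sub>M H) B'"
    and "spanned_by_cycles (with_proj (condensed_graph E))"
  shows "structurally_controllable A B"
proof -
  obtain \<sigma> where \<sigma>: "bij \<sigma>" "\<And>i. E $ \<sigma> i $ i = 1"
  proof (rule spanned_by_cycles_imp_permutation[OF assms(6)])
    fix \<sigma> assume "bij_betw \<sigma> (verts (with_proj (condensed_graph E)))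
        (verts (with_proj (condensed_graph E)))"
      and "\<And>v. v \<in> verts (with_proj (condensed_graph E)) \<Longrightarrow>
        \<exists>e\<in>arcs (with_proj (condensed_graph E)). tail (with_proj (condensed_graph E)) e = v \<and>
          head (with_proj (condensed_graph E)) e = \<sigma> v"
    then show thesis
      using that[of \<sigma>] by (force simp: condensed_graph_def)
  qed (simp add: condensed_graph_def)
  obtain M N where MN: "kalman M N" and M: "same_sparsity M (A' \<or>\<^sub>M H)" and N: "same_sparsity N B'"
    using assms(5) by (auto simp: structurally_controllable_def controllable_iff_kalman)
  \<comment> \<open>An entry outside the pattern of \<open>A'\<close> must come from \<open>H\<close>; where both allow an entry, all of it
    is given to \<open>A'\<close>.\<close>
  define M1 where "M1 = (\<chi> a b. if A' $ a $ b \<noteq> 0 then M $ a $ b else 0)"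
  define M2 where "M2 = (\<chi> a b. if A' $ a $ b \<noteq> 0 then 0 else M $ a $ b)"
  have "M1 + M2 = M"
    by (simp add: M1_def M2_def vec_eq_iff)
  then obtain c where c: "kalman ((mat 1 \<otimes>\<^sub>K M1) + (map_matrix ((*) c) (perm_mat \<sigma>) \<otimes>\<^sub>K M2))
      (mat 1 \<otimes>\<^sub>K N)"
    using kalman_permutation_coupling[of M1 M2 N \<sigma>] MN \<sigma>(1) by auto
  have M1: "A' $ a $ b \<noteq> 0" if "M1 $ a $ b \<noteq> 0" for a b
    using that by (auto simp: M1_def split: if_splits)
  have M2: "H $ a $ b \<noteq> 0" if "M2 $ a $ b \<noteq> 0" for a b
    using that M by (auto simp: M2_def same_sparsity_def mat_or_def or_bit_eq_0_iff split: if_splits)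
  show ?thesis
  proof (rule structurally_controllable_if_kalman[OF c])
    fix q s
    assume "((mat 1 \<otimes>\<^sub>K M1) + (map_matrix ((*) c) (perm_mat \<sigma>) \<otimes>\<^sub>K M2)) $ q $ s \<noteq> 0"
    then have "fst q = fst s \<and> M1 $ snd q $ snd s \<noteq> 0 \<or> fst q = \<sigma> (fst s) \<and> M2 $ snd q $ snd s \<noteq> 0"
      by (auto simp: kronecker_def mat_def map_matrix_def perm_mat_def split: if_splits)
    then have "(mat 1 \<otimes>\<^sub>K A') $ q $ s \<noteq> 0 \<or> (E \<otimes>\<^sub>K H) $ q $ s \<noteq> 0"
    proof (elim disjE conjE)
      assume "fst q = \<sigma> (fst s)" "M2 $ snd q $ snd s \<noteq> 0"
      then show ?thesis
        using M2 \<sigma>(2)[of "fst s"] by (simp add: kronecker_def)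
    qed (use M1 in \<open>simp add: kronecker_def mat_def\<close>)
    then show "A $ q $ s \<noteq> 0"
      by (simp add: assms(2) mat_or_def or_bit_eq_0_iff)
  next
    fix q :: "'r \<times> 'n" and s :: "'r \<times> 'p"
    assume "(mat 1 \<otimes>\<^sub>K N) $ q $ s \<noteq> 0"
    then have "fst q = fst s" "N $ snd q $ snd s \<noteq> 0"
      by (auto simp: kronecker_def mat_def split: if_splits)
    then show "B $ q $ s \<noteq> 0"
      using N by (simp add: assms(3) kronecker_def mat_def same_sparsity_def)
  qed
qed

end
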